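(* Let $p(\cdot)\in\mathcal S$ (so $p(\cdot)\ge1$) with $p(\cdot)\in LH_\infty(\mathbb Z)$. Then there is a constant $c>0$, depending only on the log-Hölder constants of $p(\cdot)$, on $p_-$ and on $p_\infty$, such that for every non-negative sequence $a\in\ell^{p(\cdot)}(\mathbb Z)$, $$\sup_{t>0}\big\|t\,\chi_{\{n\in\mathbb Z:\,Ma(n)>t\}}\big\|_{\ell^{p(\cdot)}(\mathbb Z)}\le c\,\|a\|_{\ell^{p(\cdot)}(\mathbb Z)}.$$
   Context: $\mathcal S$ is the set of bounded sequences $p(\cdot)=\{p(n)\}_{n\in\mathbb Z}$ with values in $[1,\infty)$; $p_-=\inf_n p(n)$ and $p_+=\sup_n p(n)<\infty$. For $p(\cdot)\in\mathcal S$ the modular is $\rho_{p(\cdot)}(a)=\sum_{k\in\mathbb Z}|a(k)|^{p(k)}$; $\ell^{p(\cdot)}(\mathbb Z)$ is the set of real sequences $a$ on $\mathbb Z$ such that $\rho_{p(\cdot)}(a/\lambda)<\infty$ for some $\lambda>0$, with norm $\|a\|_{\ell^{p(\cdot)}(\mathbb Z)}=\inf\{\lambda>0:\rho_{p(\cdot)}(a/\lambda)\le1\}$. A sequence $p(\cdot)$ is log-Hölder continuous at infinity, written $p(\cdot)\in LH_\infty(\mathbb Z)$, if there are positive real constants $C_\infty,p_\infty$ (the log-Hölder constants) such that $|p(n)-p_\infty|\le \frac{C_\infty}{\log(e+|n|)}$ for all $n\in\mathbb Z$. The Hardy–Littlewood maximal operator is $Ma(n)=\sup_{I\ni n}\frac1{|I|}\sum_{k\in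 I}|a(k)|$, where the supremum is over all (finite) intervals $I$ of integers containing $n$ and $|I|$ is the cardinality of $I$. $\chi_E$ is the indicator sequence of $E\subset\mathbb Z$. *)

theory Defs
  imports "HOL-Analysis.Analysis"
begin

definition exponents :: "(int \<Rightarrow> real) set" where
  "exponents = {p. (\<forall>n. 1 \<le> p n) \<and> bdd_above (range p)}"

definition p_minus :: "(int \<Rightarrow> real) \<Rightarrow> real" where
  "p_minus p = (INF n. p n)"

text \<open>The constants are explicit arguments, so that one can say what a bound depends on.\<close>

definition log_holder_infinity :: "real \<Rightarrow> real \<Rightarrow> (int \<Rightarrow> real) \<Rightarrow> bool" where
  "log_holder_infinity C p_inf p \<longleftrightarrow>
     0 < C \<and> 0 < p_inf \<and> (\<forall>n. \<bar>p n - p_inf\<bar> \<le> C / ln (exp 1 + \<bar>real_of_int n\<bar>))"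

definition modular :: "(int \<Rightarrow> real) \<Rightarrow> (int \<Rightarrow> real) \<Rightarrow> ennreal" where
  "modular p a = (\<Sum>\<^sub>\<infinity>k. ennreal (\<bar>a k\<bar> powr p k))"

definition lp_space :: "(int \<Rightarrow> real) \<Rightarrow> (int \<Rightarrow> real) set" where
  "lp_space p = {a. \<exists>s>0. modular p (\<lambda>k. a k / s) < \<infinity>}"

text \<open>The infimum is taken in the extended nonnegative reals, so that it is infinite
  when no admissible scaling exists, that is, for sequences outside the space.\<close>

definition lp_norm :: "(int \<Rightarrow> real) \<Rightarrow> (int \<Rightarrow> real) \<Rightarrow> ennreal" where
  "lp_norm p a = Inf {ennreal s |s. 0 < s \<and> modular p (\<lambda>k. a k / s) \<le> 1}"

text \<open>The supremum may be infinite for a general sequence, hence the extended codomain.\<close>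

definition maximal :: "(int \<Rightarrow> real) \<Rightarrow> int \<Rightarrow> ennreal" where
  "maximal a n =
     (SUP I \<in> {I. n \<in> I \<and> (\<exists>l r. I = {l..r})}. ennreal ((\<Sum>k\<in>I. \<bar>a k\<bar>) / real (card I)))"

end

theory Submission
  imports Defs
begin

text \<open>
  By homogeneity it is enough to treat sequences of modular at most one, whose values are at
  most one. For \<open>0 \<le> x \<le> 1\<close> the log-Holder condition makes \<open>x powr p n\<close> and \<open>x powr p_inf\<close>
  comparable up to the summable error \<open>1 / (e + \<bar>n\<bar>)^2\<close>: the factor \<open>x powr (-\<bar>p n - p_inf\<bar>)\<close>
  is bounded as soon as \<open>x \<ge> 1 / (e + \<bar>n\<bar>)^2\<close>. This reduces the claim to the weak type
  inequality for the constant exponent \<open>p_inf \<ge> 1\<close>, which follows from a covering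
  argument and the convexity of \<open>x powr p_inf\<close>.
\<close>

section \<open>The weak type inequality for a constant exponent\<close>

text \<open>The convex function \<open>y powr q\<close> lies above its tangent at
  \<open>y = 1\<close>; take \<open>y = x / t\<close> and scale by \<open>t powr q\<close>. This is
  Bernoulli's inequality, obtained from Young's.\<close>

lemma powr_ge_tangent:
  fixes q t x :: real
  assumes "1 \<le> q" "0 < t" "0 \<le> x"
  shows "t powr q * (1 + q * (x / t - 1)) \<le> x powr q"
proof (cases "x = 0")
  case True
  then show ?thesis using assms by (simp add: mult_le_0_iff)
next
  case False
  define y where "y = x / t"
  have y: "0 < y" using False assms by (simp add: y_def)
  \<comment> \<open>Weighted AM-GM for \<open>y powr q\<close> and \<open>1\<close>, with weights
    \<open>1/q\<close> and \<open>1 - 1/q\<close>.\<close>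
  have "(y powr q) powr (1/q) * 1 powr (1 - 1/q) \<le> (1/q) * y powr q + (1 - 1/q) * 1"
    using assms y by (intro Youngs_inequality_0) auto
  then have "y \<le> (1/q) * y powr q + (1 - 1/q)"
    using assms y by (simp add: powr_powr)
  then have "q * y \<le> q * ((1/q) * y powr q + (1 - 1/q))"
    using assms by (intro mult_left_mono) auto
  then have "1 + q * (y - 1) \<le> y powr q" using assms by (simp add: algebra_simps)
  then have "t powr q * (1 + q * (y - 1)) \<le> t powr q * y powr q"
    by (intro mult_left_mono) auto
  also have "\<dots> = x powr q"
    using assms y by (simp add: y_def powr_divide)
  finally show ?thesis by (simp add: y_def)
qed

text \<open>Jensen's inequality: sum the tangent bounds at \<open>t\<close> over \<open>I\<close>.
  The linear terms add up to a nonnegative amount because the average is at least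
  \<open>t\<close>.\<close>

lemma card_powr_le_sum_powr:
  fixes f :: "'a \<Rightarrow> real"
  assumes "finite I" "I \<noteq> {}" "1 \<le> q" "0 < t" "\<And>k. k \<in> I \<Longrightarrow> 0 \<le> f k"
    and avg: "t \<le> (\<Sum>k\<in>I. f k) / real (card I)"
  shows "real (card I) * t powr q \<le> (\<Sum>k\<in>I. f k powr q)"
proof -
  have "0 < real (card I)" using assms by (simp add: card_gt_0_iff)
  then have "t * real (card I) \<le> (\<Sum>k\<in>I. f k)"
    using avg by (simp add: le_divide_eq)
  then have "0 \<le> (\<Sum>k\<in>I. f k) / t - real (card I)"
    using \<open>0 < t\<close> by (simp add: le_divide_eq mult.commute)
  then have nonneg: "0 \<le> t powr q * (q * ((\<Sum>k\<in>I. f k) / t - real (card I)))"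
    using assms by (intro mult_nonneg_nonneg) auto
  have "real (card I) * t powr q + t powr q * (q * ((\<Sum>k\<in>I. f k) / t - real (card I)))
      = (\<Sum>k\<in>I. t powr q * (1 + q * (f k / t - 1)))"
    by (simp add: sum_distrib_left[symmetric] sum_divide_distrib[symmetric] sum.distrib
        sum_subtractf distrib_left)
  also have "\<dots> \<le> (\<Sum>k\<in>I. f k powr q)"
    using assms by (intro sum_mono powr_ge_tangent) auto
  finally show ?thesis using nonneg by linarith
qed

text \<open>Finite Vitali covering by greedy choice: keep a longest interval \<open>I\<close>, drop
  all intervals that meet it, and recurse on the rest. The dropped ones lie in an enlargement of
  \<open>I\<close> of at most three times its cardinality.\<close>

lemma finite_interval_covering:
  fixes A :: "int set set"
  assumes "finite A" and "\<And>I. I \<in> A \<Longrightarrow> \<exists>l r. l \<le> r \<and> I = {l..r}"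
  shows "\<exists>B\<subseteq>A. pairwise disjnt B \<and> card (\<Union>A) \<le> 3 * (\<Sum>I\<in>B. card I)"
  using assms
proof (induction A rule: finite_psubset_induct)
  case (psubset A)
  show ?case
  proof (cases "A = {}")
    case True
    then show ?thesis by simp
  next
    case False
    have "Max (card ` A) \<in> card ` A" using False psubset.hyps by (intro Max_in) auto
    then obtain I where I: "I \<in> A" "Max (card ` A) = card I" by auto
    have I_max: "card J \<le> card I" if "J \<in> A" for J
      using that I psubset.hyps by (metis Max_ge finite_imageI imageI)
    obtain l r where lr: "l \<le> r" "I = {l..r}" using psubset.prems I by blast
    define A' where "A' = {J \<in> A. disjnt I J}"
    have "I \<notin> A'" using lr by (auto simp: A'_def disjnt_def)
    then have "A' \<subset> A" using I by (metis (no_types, lifting) A'_def mem_Collect_eq psubsetI subsetI)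
    then obtain B where B: "B \<subseteq> A'" "pairwise disjnt B"
        "card (\<Union>A') \<le> 3 * (\<Sum>I\<in>B. card I)"
      using psubset.IH[of A'] psubset.prems by blast
    have finA': "finite A'" using psubset.hyps by (simp add: A'_def)
    then have finB: "finite B" using B finite_subset by blast
    have "I \<notin> B" using B \<open>I \<notin> A'\<close> by auto
    \<comment> \<open>An interval that meets \<open>I\<close> and is no longer than \<open>I\<close>
      sticks out by at most \<open>r - l\<close> on either side. The enlargement has
      \<open>3 * (r - l) + 1\<close> points.\<close>
    let ?I3 = "{l - (r - l)..r + (r - l)}"
    have cover: "\<Union>A \<subseteq> \<Union>A' \<union> ?I3"
    proof
      fix x assume "x \<in> \<Union>A"
      then obtain J where J: "J \<in> A" "x \<in> J" by auto
      show "x \<in> \<Union>A' \<union> ?I3"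
      proof (cases "disjnt I J")
        case True
        then show ?thesis using J by (auto simp: A'_def)
      next
        case False
        obtain u v where uv: "u \<le> v" "J = {u..v}" using psubset.prems J by blast
        have "v - u \<le> r - l" using I_max[OF J(1)] uv lr by auto
        moreover obtain y where "y \<in> I" "y \<in> J" using False by (auto simp: disjnt_def)
        ultimately show ?thesis using uv lr J(2) by auto
      qed
    qed
    have "finite (\<Union>A' \<union> ?I3)"
      using finA' psubset.prems by (fastforce simp: A'_def)
    then have "card (\<Union>A) \<le> card (\<Union>A' \<union> ?I3)" using cover by (rule card_mono)
    also have "\<dots> \<le> card (\<Union>A') + card ?I3" by (rule card_Un_le)
    also have "card ?I3 \<le> 3 * card I" using lr by (simp add: nat_le_iff)
    also have "card (\<Union>A') + 3 * card I \<le> 3 * (\<Sum>I\<in>insert I B. card I)"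
      using B \<open>I \<notin> B\<close> finB by simp
    finally have "card (\<Union>A) \<le> 3 * (\<Sum>I\<in>insert I B. card I)" by simp
    moreover have "pairwise disjnt (insert I B)"
      using B by (auto simp: pairwise_insert A'_def disjnt_sym)
    moreover have "insert I B \<subseteq> A" using I B \<open>A' \<subset> A\<close> by auto
    ultimately show ?thesis by blast
  qed
qed

lemma maximal_gt_imp_interval:
  assumes "ennreal t < maximal a n" "0 \<le> t"
  obtains l r where "l \<le> n" "n \<le> r" "t < (\<Sum>k\<in>{l..r}. \<bar>a k\<bar>) / real (card {l..r})"
proof -
  obtain I where "I \<in> {I. n \<in> I \<and> (\<exists>l r. I = {l..r})}"
      "ennreal t < ennreal ((\<Sum>k\<in>I. \<bar>a k\<bar>) / real (card I))"
    using assms unfolding maximal_def less_SUP_iff by blast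
  then show ?thesis using that assms(2) by (auto simp: ennreal_less_iff)
qed

text \<open>The level set is replaced by an arbitrary finite part \<open>G\<close> and the right
  side by a finite sum, so that no summability of \<open>\<bar>a k\<bar> powr q\<close> has to be
  known beforehand. The factor 3 comes from the covering.\<close>

lemma maximal_weak_type:
  fixes a :: "int \<Rightarrow> real"
  assumes "1 \<le> q" "0 < t" "finite G" and G: "\<And>n. n \<in> G \<Longrightarrow> ennreal t < maximal a n"
  obtains H where "finite H" "real (card G) * t powr q \<le> 3 * (\<Sum>k\<in>H. \<bar>a k\<bar> powr q)"
proof -
  have "\<exists>I. n \<in> I \<and> (\<exists>l r. l \<le> r \<and> I = {l..r}) \<and> t < (\<Sum>k\<in>I. \<bar>a k\<bar>) / real (card I)"
    if n: "n \<in> G" for n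
  proof -
    obtain l r where "l \<le> n" "n \<le> r" "t < (\<Sum>k\<in>{l..r}. \<bar>a k\<bar>) / real (card {l..r})"
      using maximal_gt_imp_interval[OF G[OF n]] assms by auto
    then show ?thesis by (intro exI[of _ "{l..r}"]) force
  qed
  then obtain F where F: "\<And>n. n \<in> G \<Longrightarrow> n \<in> F n"
      "\<And>n. n \<in> G \<Longrightarrow> \<exists>l r. l \<le> r \<and> F n = {l..r}"
      "\<And>n. n \<in> G \<Longrightarrow> t < (\<Sum>k\<in>F n. \<bar>a k\<bar>) / real (card (F n))"
    by metis
  obtain B where B: "B \<subseteq> F ` G" "pairwise disjnt B" "card (\<Union>(F ` G)) \<le> 3 * (\<Sum>I\<in>B. card I)"
    using finite_interval_covering[of "F ` G"] F(2) \<open>finite G\<close> by blast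
  have finB: "finite B" using B \<open>finite G\<close> by (auto intro: finite_subset)
  have intvl: "finite I \<and> I \<noteq> {} \<and> t \<le> (\<Sum>k\<in>I. \<bar>a k\<bar>) / real (card I)" if I: "I \<in> B" for I
  proof -
    obtain n where n: "n \<in> G" "I = F n" using B I by auto
    then show ?thesis using F(2)[of n] F(3)[of n] by auto
  qed
  \<comment> \<open>Finiteness matters: the \<open>card\<close> of an infinite set is 0.\<close>
  have "finite (\<Union>(F ` G))" using F(2) \<open>finite G\<close> by fastforce
  then have "card G \<le> card (\<Union>(F ` G))" using F(1) by (intro card_mono) auto
  then have "real (card G) \<le> real (3 * (\<Sum>I\<in>B. card I))" using B by linarith
  then have "real (card G) * t powr q \<le> 3 * (\<Sum>I\<in>B. real (card I)) * t powr q"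
    by (intro mult_right_mono) auto
  also have "\<dots> = 3 * (\<Sum>I\<in>B. real (card I) * t powr q)"
    by (simp add: sum_distrib_right)
  also have "\<dots> \<le> 3 * (\<Sum>I\<in>B. \<Sum>k\<in>I. \<bar>a k\<bar> powr q)"
    using intvl assms by (intro mult_left_mono sum_mono card_powr_le_sum_powr) auto
  \<comment> \<open>The chosen intervals are disjoint, so no point is counted twice.\<close>
  also have "(\<Sum>I\<in>B. \<Sum>k\<in>I. \<bar>a k\<bar> powr q) = (\<Sum>k\<in>\<Union>B. \<bar>a k\<bar> powr q)"
    using B(2) intvl by (subst sum.Union_disjoint) (auto simp: pairwise_def disjnt_def)
  finally show ?thesis using that[of "\<Union>B"] finB intvl by blast
qed

section \<open>Comparison of exponents\<close>

text \<open>For tiny \<open>x\<close> the error term absorbs \<open>x powr p \<le> x\<close>.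
  Otherwise \<open>\<bar>ln x\<bar> \<le> 2 * ln R\<close>, and changing the exponent costs a factor
  of at most \<open>exp (\<bar>p - q\<bar> * \<bar>ln x\<bar>) \<le> exp (2 * C)\<close>.\<close>

lemma powr_le_powr_log_error:
  fixes x p q C R :: real
  assumes "0 \<le> x" "x \<le> 1" "1 \<le> p" "exp 1 \<le> R" "0 < C" "\<bar>p - q\<bar> \<le> C / ln R"
  shows "x powr p \<le> exp (2 * C) * x powr q + 1 / R\<^sup>2"
proof (cases "x \<le> 1 / R\<^sup>2")
  case True
  have "x powr p \<le> x"
    using assms powr_mono'[of 1 p x] by simp
  moreover have "0 \<le> exp (2 * C) * x powr q" by simp
  ultimately show ?thesis using True by linarith
next
  case False
  have R: "0 < R" using assms by (meson exp_gt_zero less_le_trans)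
  then have lnR: "1 \<le> ln R" using assms by (simp add: ln_ge_iff)
  have x: "0 < x" using False R
    by (smt (verit) divide_pos_pos zero_less_power)
  have "ln (1 / R\<^sup>2) \<le> ln x" using False x R by simp
  then have lnx: "- ln x \<le> 2 * ln R" using R by (simp add: ln_div ln_realpow)
  have "(p - q) * ln x \<le> \<bar>p - q\<bar> * \<bar>ln x\<bar>"
    by (metis abs_ge_self abs_mult)
  also have "\<bar>ln x\<bar> = - ln x" using x assms by simp
  also have "\<bar>p - q\<bar> * (- ln x) \<le> C / ln R * (2 * ln R)"
    using assms lnx lnR x by (intro mult_mono) auto
  also have "\<dots> = 2 * C" using lnR by simp
  finally have "p * ln x \<le> 2 * C + q * ln x" by (simp add: algebra_simps)
  then have "exp (p * ln x) \<le> exp (2 * C) * exp (q * ln x)" by (simp flip: exp_add)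
  then have "x powr p \<le> exp (2 * C) * x powr q" using x by (simp add: powr_def)
  moreover have "0 \<le> 1 / R\<^sup>2" by simp
  ultimately show ?thesis by linarith
qed

text \<open>Supplies a universal \<open>S\<close> for the accumulated comparison errors, independent
  of the exponent sequence.\<close>

lemma int_inverse_squares_sum_bounded:
  obtains S :: real where "0 \<le> S"
    "\<And>F. finite F \<Longrightarrow> (\<Sum>n\<in>F. 1 / (exp 1 + \<bar>real_of_int n\<bar>)\<^sup>2) \<le> S"
proof
  let ?f = "\<lambda>n::nat. 1 / (real n + 1)\<^sup>2"
  let ?g = "\<lambda>n::int. 1 / (exp 1 + \<bar>real_of_int n\<bar>)\<^sup>2"
  have summ: "summable ?f" using inverse_squares_sums by (simp add: sums_iff add.commute)
  show "0 \<le> 2 * suminf ?f" using summ by (simp add: suminf_nonneg)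
  have g_le: "?g n \<le> ?f (nat \<bar>n\<bar>)" for n
  proof -
    have "1 \<le> exp (1::real)" by simp
    then have "real (nat \<bar>n\<bar>) + 1 \<le> exp 1 + \<bar>real_of_int n\<bar>" by simp
    then show ?thesis by (intro divide_left_mono power_mono mult_pos_pos zero_less_power) (auto intro: add_pos_nonneg)
  qed
  \<comment> \<open>Injectivity of the absolute value holds on the nonnegative and on the negative
    integers separately; each half contributes one copy of the series.\<close>
  have half: "sum ?g H \<le> suminf ?f" if "finite H" "inj_on (\<lambda>n. nat \<bar>n\<bar>) H" for H
  proof -
    have "sum ?g H \<le> (\<Sum>n\<in>H. ?f (nat \<bar>n\<bar>))" by (intro sum_mono g_le)
    also have "\<dots> = sum ?f ((\<lambda>n. nat \<bar>n\<bar>) ` H)" using that by (simp add: sum.reindex)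
    also have "\<dots> \<le> suminf ?f" using that summ by (intro sum_le_suminf) auto
    finally show ?thesis .
  qed
  show "sum ?g F \<le> 2 * suminf ?f" if "finite F" for F
  proof -
    have "sum ?g F = sum ?g (F \<inter> {0..}) + sum ?g (F - {0..})"
      using that by (rule sum.Int_Diff)
    moreover have "sum ?g (F \<inter> {0..}) \<le> suminf ?f"
      using that by (intro half) (auto simp: inj_on_def)
    moreover have "sum ?g (F - {0..}) \<le> suminf ?f"
      using that by (intro half) (auto simp: inj_on_def)
    ultimately show ?thesis by linarith
  qed
qed

text \<open>The bound forces \<open>p n\<close> to tend to \<open>p_inf\<close>, so the limit
  inherits the lower bound 1. The convexity argument for the exponent \<open>p_inf\<close> relies on
  this.\<close>

lemma log_holder_limit_ge_1:
  assumes "p \<in> exponents" "log_holder_infinity C p_inf p"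
  shows "1 \<le> p_inf"
proof (rule ccontr)
  assume "\<not> 1 \<le> p_inf"
  then have d: "0 < 1 - p_inf" by simp
  \<comment> \<open>Chosen so that \<open>C / K = 1 - p_inf\<close>; a point where the logarithm
    exceeds \<open>K\<close> then gives the contradiction.\<close>
  define K where "K = C / (1 - p_inf)"
  obtain N :: nat where N: "exp K < real N" using reals_Archimedean2 by blast
  let ?R = "exp 1 + \<bar>real_of_int (int N)\<bar>"
  have "exp K < ?R" using N by (simp add: add_strict_increasing)
  then have K: "K < ln ?R" by (metis exp_gt_zero less_trans ln_exp ln_less_cancel_iff)
  have C: "0 < C" using assms by (simp add: log_holder_infinity_def)
  then have "0 < K" using d by (simp add: K_def)
  have "1 \<le> p (int N)" using assms by (simp add: exponents_def)
  then have "1 - p_inf \<le> \<bar>p (int N) - p_inf\<bar>" by linarith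
  also have "\<dots> \<le> C / ln ?R" using assms unfolding log_holder_infinity_def by blast
  also have "\<dots> < C / K" using C K \<open>0 < K\<close> by (intro divide_strict_left_mono) auto
  also have "\<dots> = 1 - p_inf" using C by (simp add: K_def)
  finally show False by simp
qed

section \<open>The weak type inequality for a variable exponent\<close>

text \<open>Turns bounds on the extended-valued modular into real inequalities for finite
  sums.\<close>

lemma modular_le_iff:
  assumes "0 \<le> B"
  shows "modular p a \<le> ennreal B \<longleftrightarrow> (\<forall>F. finite F \<longrightarrow> (\<Sum>k\<in>F. \<bar>a k\<bar> powr p k) \<le> B)"
proof -
  have "modular p a = (SUP F\<in>{F. finite F \<and> F \<subseteq> UNIV}. \<Sum>k\<in>F. ennreal (\<bar>a k\<bar> powr p k))"
    unfolding modular_def by (rule nonneg_infsum_complete) simp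
  then show ?thesis using assms by (simp add: SUP_le_iff)
qed

text \<open>Pass from \<open>p n\<close> to the constant exponent \<open>q\<close> on the level set,
  apply the weak type inequality, then return from \<open>q\<close> to \<open>p k\<close> on the
  side of \<open>a\<close>. Each passage costs a factor \<open>exp (2 * C)\<close> and an error
  \<open>S\<close>.\<close>

lemma level_set_sum_bound:
  fixes a :: "int \<Rightarrow> real"
  assumes p: "p \<in> exponents" "log_holder_infinity C q p"
    and S: "\<And>F. finite F \<Longrightarrow> (\<Sum>n\<in>F. 1 / (exp 1 + \<bar>real_of_int n\<bar>)\<^sup>2) \<le> S"
    and a: "modular p a \<le> 1" and t: "0 < t"
    and G: "finite G" "\<And>n. n \<in> G \<Longrightarrow> ennreal t < maximal a n"
  shows "(\<Sum>n\<in>G. t powr p n) \<le> 3 * exp (2 * C) * (exp (2 * C) + S) + S"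
proof (cases "G = {}")
  case True
  have "0 \<le> S" using S[of "{}"] by simp
  then show ?thesis using True by simp
next
  case False
  let ?R = "\<lambda>n::int. exp 1 + \<bar>real_of_int n\<bar>"
  let ?K = "exp (2 * C)"
  have p1: "1 \<le> p n" for n using p by (simp add: exponents_def)
  have C: "0 < C" and lh: "\<bar>p n - q\<bar> \<le> C / ln (?R n)" for n
    using p by (auto simp: log_holder_infinity_def)
  have q1: "1 \<le> q" using p by (rule log_holder_limit_ge_1)
  have a_sum: "(\<Sum>k\<in>F. \<bar>a k\<bar> powr p k) \<le> 1" if "finite F" for F
    using a that modular_le_iff[of 1 p a] by simp
  have a1: "\<bar>a k\<bar> \<le> 1" for k
  proof (rule ccontr)
    assume "\<not> \<bar>a k\<bar> \<le> 1"
    then have "1 < \<bar>a k\<bar> powr p k" using p1[of k] by (intro gr_one_powr) auto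
    then show False using a_sum[of "{k}"] by simp
  qed
  \<comment> \<open>Averages of values at most 1 stay at most 1, so a nonempty level set forces
    \<open>t \<le> 1\<close>, as the comparison of exponents requires.\<close>
  have t1: "t \<le> 1"
  proof -
    obtain n where "n \<in> G" using False by auto
    then obtain l r where lr: "l \<le> n" "n \<le> r" "t < (\<Sum>k\<in>{l..r}. \<bar>a k\<bar>) / real (card {l..r})"
      using maximal_gt_imp_interval[OF G(2)] t by (metis less_imp_le)
    have "(\<Sum>k\<in>{l..r}. \<bar>a k\<bar>) \<le> real (card {l..r})"
      using sum_bounded_above[of "{l..r}" "\<lambda>k. \<bar>a k\<bar>" 1] a1 by simp
    then have "(\<Sum>k\<in>{l..r}. \<bar>a k\<bar>) / real (card {l..r}) \<le> 1"
      using lr by (simp add: divide_le_eq)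
    then show ?thesis using lr by linarith
  qed
  obtain H where H: "finite H" "real (card G) * t powr q \<le> 3 * (\<Sum>k\<in>H. \<bar>a k\<bar> powr q)"
    using maximal_weak_type[OF q1 t G] by blast
  \<comment> \<open>The comparison with the roles of the exponents exchanged: here
    \<open>1 \<le> q\<close> handles the tiny values.\<close>
  have "(\<Sum>k\<in>H. \<bar>a k\<bar> powr q) \<le> (\<Sum>k\<in>H. ?K * \<bar>a k\<bar> powr p k + 1 / (?R k)\<^sup>2)"
    using a1 q1 C lh
    by (intro sum_mono powr_le_powr_log_error) (auto simp: abs_minus_commute)
  also have "\<dots> = ?K * (\<Sum>k\<in>H. \<bar>a k\<bar> powr p k) + (\<Sum>k\<in>H. 1 / (?R k)\<^sup>2)"
    by (simp add: sum.distrib sum_distrib_left)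
  also have "\<dots> \<le> ?K * 1 + S"
    using a_sum S H by (intro add_mono mult_left_mono) auto
  finally have Hb: "real (card G) * t powr q \<le> 3 * (?K + S)" using H by simp
  have "(\<Sum>n\<in>G. t powr p n) \<le> (\<Sum>n\<in>G. ?K * t powr q + 1 / (?R n)\<^sup>2)"
    using t t1 p1 C lh by (intro sum_mono powr_le_powr_log_error) auto
  also have "\<dots> = ?K * (real (card G) * t powr q) + (\<Sum>n\<in>G. 1 / (?R n)\<^sup>2)"
    by (simp add: sum.distrib)
  also have "\<dots> \<le> ?K * (3 * (?K + S)) + S"
    using Hb S G by (intro add_mono mult_left_mono) auto
  finally show ?thesis by (simp only: mult.left_commute mult.assoc)
qed

lemma maximal_divide_gt:
  assumes "0 < s" "0 < t" "ennreal t < maximal a n"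
  shows "ennreal (t / s) < maximal (\<lambda>k. a k / s) n"
proof -
  obtain l r where lr: "l \<le> n" "n \<le> r" "t < (\<Sum>k\<in>{l..r}. \<bar>a k\<bar>) / real (card {l..r})"
    using maximal_gt_imp_interval[OF assms(3)] assms(2) by (metis less_imp_le)
  have "t / s < (\<Sum>k\<in>{l..r}. \<bar>a k\<bar>) / real (card {l..r}) / s"
    using lr assms by (intro divide_strict_right_mono) auto
  also have "\<dots> = (\<Sum>k\<in>{l..r}. \<bar>a k / s\<bar>) / real (card {l..r})"
    using assms by (simp add: sum_divide_distrib abs_divide mult.commute)
  finally have "ennreal (t / s) < ennreal ((\<Sum>k\<in>{l..r}. \<bar>a k / s\<bar>) / real (card {l..r}))"
    using assms by (subst ennreal_less_iff) auto
  also have "\<dots> \<le> maximal (\<lambda>k. a k / s) n"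
    unfolding maximal_def using lr by (intro SUP_upper) auto
  finally show ?thesis .
qed

text \<open>As \<open>c\<close> and all exponents are at least 1, \<open>c \<le> c powr p n\<close>;
  dividing a sequence by \<open>c\<close> thus divides its modular by at least
  \<open>c\<close>.\<close>

lemma modular_level_set_le_1:
  assumes p: "p \<in> exponents" and c: "1 \<le> c" and u: "0 < u"
    and E: "\<And>G. finite G \<Longrightarrow> G \<subseteq> E \<Longrightarrow> (\<Sum>n\<in>G. u powr p n) \<le> c"
  shows "modular p (\<lambda>n. u * indicator E n / c) \<le> 1"
proof -
  have "(\<Sum>n\<in>F. \<bar>u * indicator E n / c\<bar> powr p n) \<le> 1" if "finite F" for F
  proof -
    have "(\<Sum>n\<in>F. \<bar>u * indicator E n / c\<bar> powr p n) = (\<Sum>n\<in>F \<inter> E. (u / c) powr p n)"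
      using that u c by (intro sum.mono_neutral_cong_right) (auto simp: indicator_def)
    also have "\<dots> \<le> (\<Sum>n\<in>F \<inter> E. u powr p n / c)"
    proof (intro sum_mono)
      fix n
      have "1 \<le> p n" using p by (simp add: exponents_def)
      then have "c \<le> c powr p n" using c powr_mono[of 1 "p n" c] by simp
      then have "u powr p n / c powr p n \<le> u powr p n / c"
        using c by (intro divide_left_mono) auto
      then show "(u / c) powr p n \<le> u powr p n / c"
        using u c by (simp add: powr_divide)
    qed
    also have "\<dots> = (\<Sum>n\<in>F \<inter> E. u powr p n) / c" by (simp add: sum_divide_distrib)
    also have "\<dots> \<le> 1" using E[of "F \<inter> E"] that c by (simp add: divide_le_eq)
    finally show ?thesis .
  qed
  then show ?thesis using modular_le_iff[of 1 p] by simp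
qed

theorem theorem6p4:
  fixes C p_inf m :: real
  shows "\<exists>c>0. \<forall>p. p \<in> exponents \<longrightarrow> log_holder_infinity C p_inf p \<longrightarrow> p_minus p = m \<longrightarrow>
    (\<forall>a. a \<in> lp_space p \<longrightarrow> (\<forall>n. 0 \<le> a n) \<longrightarrow>
      (SUP t\<in>{0<..}. lp_norm p (\<lambda>n. t * indicator {n. maximal a n > ennreal t} n))
        \<le> ennreal c * lp_norm p a)"
proof -
  obtain S :: real where S: "0 \<le> S"
      "\<And>F. finite F \<Longrightarrow> (\<Sum>n\<in>F. 1 / (exp 1 + \<bar>real_of_int n\<bar>)\<^sup>2) \<le> S"
    using int_inverse_squares_sum_bounded by blast
  \<comment> \<open>Fixed before \<open>p\<close> and built from \<open>C\<close> and the universal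
    \<open>S\<close> alone; the maximum with 1 is for \<open>modular_level_set_le_1\<close>.\<close>
  define c where "c = max 1 (3 * exp (2 * C) * (exp (2 * C) + S) + S)"
  have c1: "1 \<le> c" by (simp add: c_def)
  have main: "lp_norm p (\<lambda>n. t * indicator {n. maximal a n > ennreal t} n)
      \<le> ennreal c * lp_norm p a"
    if p: "p \<in> exponents" "log_holder_infinity C p_inf p" and t: "0 < t" for p a t
  proof -
    let ?E = "{n. maximal a n > ennreal t}"
    let ?L = "lp_norm p (\<lambda>n. t * indicator ?E n)"
    \<comment> \<open>Normalise by \<open>s\<close>: the level set of \<open>a\<close> at
      \<open>t\<close> lies in that of \<open>a / s\<close> at \<open>t / s\<close>, and undoing the
      scaling makes \<open>c * s\<close> admissible for the left norm.\<close>
    have scaled: "?L \<le> ennreal c * ennreal s"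
      if s: "0 < s" "modular p (\<lambda>k. a k / s) \<le> 1" for s
    proof -
      have "(\<Sum>n\<in>G. (t / s) powr p n) \<le> c" if "finite G" "G \<subseteq> ?E" for G
        unfolding c_def using maximal_divide_gt[OF s(1) t] s(1) t that
        by (intro max.coboundedI2 level_set_sum_bound[OF p S(2) s(2)]) auto
      then have "modular p (\<lambda>n. t / s * indicator ?E n / c) \<le> 1"
        using s t c1 p by (intro modular_level_set_le_1) auto
      then have "modular p (\<lambda>n. t * indicator ?E n / (c * s)) \<le> 1"
        by (simp add: mult.commute)
      then have "?L \<le> ennreal (c * s)"
        unfolding lp_norm_def using s c1 by (intro Inf_lower) auto
      then show ?thesis using s c1 by (simp add: ennreal_mult)
    qed
    \<comment> \<open>Dividing by \<open>c\<close> first lets the right side be handled as a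
      greatest lower bound over admissible \<open>s\<close>; \<open>c\<close> is positive and
      finite, so it cancels afterwards.\<close>
    have "?L / ennreal c \<le> lp_norm p a"
      unfolding lp_norm_def[of p a]
    proof (rule Inf_greatest, clarify)
      fix s assume s: "0 < (s::real)" "modular p (\<lambda>k. a k / s) \<le> 1"
      show "?L / ennreal c \<le> ennreal s"
        using scaled[OF s] c1 by (intro divide_le_posI_ennreal) auto
    qed
    then have "ennreal c * (?L / ennreal c) \<le> ennreal c * lp_norm p a"
      by (rule mult_left_mono) simp
    then show ?thesis
      using c1 by (simp add: ennreal_times_divide mult_divide_eq_ennreal mult.commute[of "ennreal c" ?L])
  qed
  show ?thesis
    using c1 main by (intro exI[of _ c]) (auto intro!: SUP_least)
qed

end
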